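(* Let $\mathcal T$ and $\mathcal S$ be local approximation classes in $\mathbb{R}^n$ such that $\mathcal T$ is separated at infinity in $\overline{\mathcal S}$. If a nonempty set $A\subseteq\mathbb{R}^n$ is locally well approximated by $\mathcal S$, then $A$ can be written as a disjoint union $$A=A_{\overline{\mathcal T}}\cup A_{\mathcal T^\perp},\qquad A_{\overline{\mathcal T}}\cap A_{\mathcal T^\perp}=\emptyset,$$ where $\mathrm{Tan}(\overline A,x)\subseteq\overline{\mathcal S}\cap\overline{\mathcal T}$ for all $x\in A_{\overline{\mathcal T}}$ and $\mathrm{Tan}(\overline A,x)\subseteq\overline{\mathcal S}\cap\mathcal T^\perp$ for all $x\in A_{\mathcal T^\perp}$.
   Context: $B(x,r)$ denotes the closed ball in $\mathbb{R}^n$ and $\overline A$ the closure of $A$. $\mathfrak C(0)$ is the collection of closed subsets of $\mathbb{R}^n$ containing $0$. For $A,B\subseteq\mathbb{R}^n$ with $B\neq\emptyset$, $\mathrm{ex}(A,B)=\sup_{a\in A}\inf_{b\in B}|a-b|$, with $\mathrm{ex}(\emptyset,B)=0$. Nonempty closed sets $A_i$ converge to a nonempty closed set $A$ (Attouch--Wets topology, which is metrizable), $A_i\to A$, if $\mathrm{ex}(A_i\cap B(0,r),A)\to0$ and $\mathrm{ex}(A\cap B(0,r),A_i)\to 0$ for all $r>0$. For $\mathcal S\subseteq\mathfrak C(0)$, $\overline{\mathcal S}$ is the closure of $\mathcal S$ in $\mathfrak C(0)$ in this topology. A local approximation class is a nonempty collection $\mathcal S\subseteq\mathfrak C(0)$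 such that $\lambda S\in\mathcal S$ for all $S\in\mathcal S$, $\lambda>0$. For nonempty $A,B$ put $\widetilde{\mathrm D}^{x,r}[A,B]=\frac1r\max\{\mathrm{ex}(A\cap B(x,r),B),\mathrm{ex}(B\cap B(x,r),A)\}$, and $\Theta^{\mathcal S}_A(x,r)=\inf_{S\in\mathcal S}\widetilde{\mathrm D}^{x,r}[A,x+S]$. A nonempty set $A$ is locally well approximated by $\mathcal S$ if for every $\varepsilon>0$ and every compact $K\subseteq A$ there is $r_K>0$ such that $\Theta^{\mathcal S}_A(x,r)\leq\varepsilon$ for all $x\in K$ and $0<r\leq r_K$. For closed $A$ and $x\in A$, $\mathrm{Tan}(A,x)$ is the collection of $T\in\mathfrak C(0)$ such that $(A-x)/r_i\to T$ for some sequence $r_i>0$ with $r_i\to0$. Singular class: $\mathcal T^\perp=\{D\in\mathfrak C(0):\liminf_{r\downarrow0}\Theta^{\mathcal T}_D(0,r)>0\}$ (equivalently, $\{D\in\mathfrak C(0):\mathrm{Tan}(D,0)\cap\overline{\mathcal T}=\emptyset\}$). $\mathcal T$ is separated at infinity in a class $\mathcal R$ if there exists $\phi>0$ such that $\limsup_{r\uparrow\infty}\Theta^{\mathcal T}_S(0,r)\geq\phi$ for all $S\in\mathcal R\setminus\overline{\mathcal T}$. *)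

theory Defs
  imports "HOL-Analysis.Analysis"
begin

text \<open>Excess of \<open>A\<close> over \<open>B\<close>, with values in \<open>[0, \<infinity>]\<close>. The supremum over the empty
  set is \<open>0\<close> in \<^typ>\<open>ennreal\<close>. Only nonempty \<open>B\<close> is meant: \<^const>\<open>infdist\<close> is then the
  infimum of the distances to points of \<open>B\<close>.\<close>

definition excess :: "'a::euclidean_space set \<Rightarrow> 'a set \<Rightarrow> ennreal" where
  "excess A B = (SUP a\<in>A. ennreal (infdist a B))"

definition closed_sets0 :: "'a::euclidean_space set set" where
  "closed_sets0 = {A. closed A \<and> 0 \<in> A}"

definition aw_converges :: "(nat \<Rightarrow> 'a::euclidean_space set) \<Rightarrow> 'a set \<Rightarrow> bool" where
  "aw_converges F A \<longleftrightarrow>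
     (\<forall>r>0. (\<lambda>i. excess (F i \<inter> cball 0 r) A) \<longlonglongrightarrow> 0 \<and>
            (\<lambda>i. excess (A \<inter> cball 0 r) (F i)) \<longlonglongrightarrow> 0)"

text \<open>The Attouch--Wets topology on \<^const>\<open>closed_sets0\<close>. It is metrizable, hence determined by its
  convergent sequences: its open sets are the sequentially open ones. That its convergent
  sequences are exactly those of \<^const>\<open>aw_converges\<close>, and that its closure is the sequential
  one, is proved below in \<open>limitin_aw_topology\<close> and \<open>aw_closure_sequential\<close>.\<close>

definition aw_topology :: "'a::euclidean_space set topology" where
  "aw_topology = topology (\<lambda>U. U \<subseteq> closed_sets0 \<and>
     (\<forall>A\<in>U. \<forall>F. range F \<subseteq> closed_sets0 \<and> aw_converges F A
        \<longrightarrow> (\<forall>\<^sub>F i in sequentially. F i \<in> U)))"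

abbreviation aw_closure :: "'a::euclidean_space set set \<Rightarrow> 'a set set" where
  "aw_closure \<S> \<equiv> aw_topology closure_of \<S>"

definition local_approx_class :: "'a::euclidean_space set set \<Rightarrow> bool" where
  "local_approx_class \<S> \<longleftrightarrow>
     \<S> \<noteq> {} \<and> \<S> \<subseteq> closed_sets0 \<and> (\<forall>S\<in>\<S>. \<forall>c>0. (*\<^sub>R) c ` S \<in> \<S>)"

text \<open>The next two notions are meant for nonempty sets and \<open>r > 0\<close>.\<close>

definition rel_dist :: "'a::euclidean_space \<Rightarrow> real \<Rightarrow> 'a set \<Rightarrow> 'a set \<Rightarrow> ennreal" where
  "rel_dist x r A B = max (excess (A \<inter> cball x r) B) (excess (B \<inter> cball x r) A) / ennreal r"

definition approximability ::
  "'a::euclidean_space set set \<Rightarrow> 'a set \<Rightarrow> 'a \<Rightarrow> real \<Rightarrow> ennreal" where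
  "approximability \<S> A x r = (INF S\<in>\<S>. rel_dist x r A ((+) x ` S))"

definition locally_well_approximated ::
  "'a::euclidean_space set \<Rightarrow> 'a set set \<Rightarrow> bool" where
  "locally_well_approximated A \<S> \<longleftrightarrow>
     A \<noteq> {} \<and>
     (\<forall>\<epsilon>>0. \<forall>K. compact K \<and> K \<subseteq> A \<longrightarrow>
        (\<exists>r\<^sub>K>0. \<forall>x\<in>K. \<forall>r. 0 < r \<and> r \<le> r\<^sub>K \<longrightarrow> approximability \<S> A x r \<le> ennreal \<epsilon>))"

text \<open>Tangent sets, for closed \<open>A\<close> and \<open>x \<in> A\<close>.\<close>

definition Tan :: "'a::euclidean_space set \<Rightarrow> 'a \<Rightarrow> 'a set set" where
  "Tan A x = {T \<in> closed_sets0. \<exists>r::nat \<Rightarrow> real. (\<forall>i. r i > 0) \<and> r \<longlonglongrightarrow> 0 \<and>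
                aw_converges (\<lambda>i. (\<lambda>y. (y - x) /\<^sub>R r i) ` A) T}"

definition singular_class :: "'a::euclidean_space set set \<Rightarrow> 'a set set" where
  "singular_class \<T> =
     {D \<in> closed_sets0. Liminf (at_right 0) (\<lambda>r. approximability \<T> D 0 r) > 0}"

definition separated_at_infinity ::
  "'a::euclidean_space set set \<Rightarrow> 'a set set \<Rightarrow> bool" where
  "separated_at_infinity \<T> \<R> \<longleftrightarrow>
     (\<exists>\<phi>::real. \<phi> > 0 \<and>
        (\<forall>S\<in>\<R> - aw_closure \<T>. Limsup at_top (\<lambda>r. approximability \<T> S 0 r) \<ge> ennreal \<phi>))"

lemma openin_aw_topology:
  "openin aw_topology U \<longleftrightarrow> U \<subseteq> closed_sets0 \<and>
     (\<forall>A\<in>U. \<forall>F. range F \<subseteq> closed_sets0 \<and> aw_converges F A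
        \<longrightarrow> (\<forall>\<^sub>F i in sequentially. F i \<in> U))" (is "_ \<longleftrightarrow> ?P U")
proof -
  have "istopology ?P"
    unfolding istopology_def
  proof (intro conjI allI impI)
    fix S T assume S: "?P S" and T: "?P T"
    show "S \<inter> T \<subseteq> closed_sets0" using S by blast
    show "\<forall>A\<in>S \<inter> T. \<forall>F. range F \<subseteq> closed_sets0 \<and> aw_converges F A
        \<longrightarrow> (\<forall>\<^sub>F i in sequentially. F i \<in> S \<inter> T)"
    proof (intro ballI allI impI)
      fix A F assume "A \<in> S \<inter> T" and F: "range F \<subseteq> closed_sets0 \<and> aw_converges F A"
      then have "\<forall>\<^sub>F i in sequentially. F i \<in> S" "\<forall>\<^sub>F i in sequentially. F i \<in> T"
        using S T by blast+
      then show "\<forall>\<^sub>F i in sequentially. F i \<in> S \<inter> T"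
        by eventually_elim blast
    qed
  next
    fix \<K> assume K: "\<forall>K\<in>\<K>. ?P K"
    show "\<Union>\<K> \<subseteq> closed_sets0" using K by blast
    show "\<forall>A\<in>\<Union>\<K>. \<forall>F. range F \<subseteq> closed_sets0 \<and> aw_converges F A
        \<longrightarrow> (\<forall>\<^sub>F i in sequentially. F i \<in> \<Union>\<K>)"
    proof (intro ballI allI impI)
      fix A F assume "A \<in> \<Union>\<K>" and F: "range F \<subseteq> closed_sets0 \<and> aw_converges F A"
      then obtain K where "K \<in> \<K>" "A \<in> K" by blast
      with K F have "\<forall>\<^sub>F i in sequentially. F i \<in> K" by blast
      then show "\<forall>\<^sub>F i in sequentially. F i \<in> \<Union>\<K>"
        by eventually_elim (use \<open>K \<in> \<K>\<close> in blast)
    qed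
  qed
  then show ?thesis
    unfolding aw_topology_def by (simp add: topology_inverse')
qed

lemma topspace_aw_topology:
  "topspace aw_topology = (closed_sets0 :: 'a::euclidean_space set set)"
proof -
  have "openin aw_topology (closed_sets0 :: 'a set set)"
    unfolding openin_aw_topology by (simp add: image_subset_iff)
  then have "closed_sets0 \<subseteq> topspace (aw_topology :: 'a set topology)"
    by (rule openin_subset)
  moreover have "topspace aw_topology \<subseteq> (closed_sets0 :: 'a set set)"
    using openin_topspace[of "aw_topology :: 'a set topology"]
    unfolding openin_aw_topology by (rule conjunct1)
  ultimately show ?thesis by (rule subset_antisym[rotated])
qed

definition aw_near :: "real \<Rightarrow> real \<Rightarrow> 'a::euclidean_space set \<Rightarrow> 'a set \<Rightarrow> bool" where
  "aw_near r e A B \<longleftrightarrow>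
     (\<forall>a\<in>A \<inter> cball 0 r. infdist a B \<le> e) \<and> (\<forall>b\<in>B \<inter> cball 0 r. infdist b A \<le> e)"

lemma excess_le_iff: "e \<ge> 0 \<Longrightarrow> excess A B \<le> ennreal e \<longleftrightarrow> (\<forall>a\<in>A. infdist a B \<le> e)"
  by (simp add: excess_def SUP_le_iff)

lemma tendsto_0_ennreal_iff_le:
  "(f \<longlongrightarrow> (0::ennreal)) F \<longleftrightarrow> (\<forall>e>0. \<forall>\<^sub>F i in F. f i \<le> ennreal e)"
proof
  assume f: "(f \<longlongrightarrow> 0) F"
  show "\<forall>e>0. \<forall>\<^sub>F i in F. f i \<le> ennreal e"
  proof (intro allI impI)
    fix e :: real assume "e > 0"
    then have "\<forall>\<^sub>F i in F. f i < ennreal e"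
      by (intro order_tendstoD(2)[OF f]) simp
    then show "\<forall>\<^sub>F i in F. f i \<le> ennreal e" by eventually_elim simp
  qed
next
  assume f: "\<forall>e>0. \<forall>\<^sub>F i in F. f i \<le> ennreal e"
  show "(f \<longlongrightarrow> 0) F"
  proof (rule order_tendstoI)
    fix a :: ennreal assume "0 < a"
    then obtain b where b: "0 < b" "b < a" using dense by blast
    then obtain e where e: "b = ennreal e" "e > 0" 
      by (cases b) (auto simp: less_top)
    then have "\<forall>\<^sub>F i in F. f i \<le> b" using f by auto
    then show "\<forall>\<^sub>F i in F. f i < a"
      by eventually_elim (use b in auto)
  qed simp
qed

lemma aw_converges_iff_near:
  "aw_converges F A \<longleftrightarrow> (\<forall>r>0. \<forall>e>0. \<forall>\<^sub>F i in sequentially. aw_near r e (F i) A)"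
proof -
  have *: "aw_near r e (F i) A \<longleftrightarrow>
      excess (F i \<inter> cball 0 r) A \<le> ennreal e \<and> excess (A \<inter> cball 0 r) (F i) \<le> ennreal e"
    if "e > 0" for r e i
    using that by (simp add: aw_near_def excess_le_iff)
  show ?thesis
    unfolding aw_converges_def tendsto_0_ennreal_iff_le
    by (auto simp: * eventually_conj_iff)
qed

lemma aw_near_mono: "aw_near r e A B \<Longrightarrow> r' \<le> r \<Longrightarrow> e \<le> e' \<Longrightarrow> aw_near r' e' A B"
  unfolding aw_near_def by (smt (verit, best) Int_iff mem_cball)

lemma aw_near_trans:
  assumes AB: "aw_near (r + 1) e A B" and BC: "aw_near (r + 1) e B C"
    and e: "e \<le> 1" and B: "B \<in> closed_sets0"
  shows "aw_near r (2 * e) A C"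
proof -
  have key: "infdist a Y \<le> 2 * e"
    if X: "aw_near (r + 1) e X B" and Y: "\<forall>b\<in>B \<inter> cball 0 (r + 1). infdist b Y \<le> e"
      and a: "a \<in> X \<inter> cball 0 r" for X Y :: "'a set" and a
  proof -
    have "closed B" "B \<noteq> {}" using B by (auto simp: closed_sets0_def)
    then obtain b where b: "b \<in> B" "infdist a B = dist a b"
      using infdist_attains_inf by blast
    have "a \<in> X \<inter> cball 0 (r + 1)" using a by auto
    then have "infdist a B \<le> e" using X unfolding aw_near_def by blast
    then have "dist a b \<le> e" using b by simp
    moreover have "dist 0 b \<le> dist 0 a + dist a b" by (rule dist_triangle)
    ultimately have "b \<in> B \<inter> cball 0 (r + 1)" using a b e by auto
    then have "infdist b Y \<le> e" using Y by blast
    moreover have "infdist a Y \<le> infdist b Y + dist a b" by (rule infdist_triangle)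
    ultimately show ?thesis using \<open>dist a b \<le> e\<close> by linarith
  qed
  have "aw_near (r + 1) e C B" using BC by (auto simp: aw_near_def)
  then show ?thesis
    unfolding aw_near_def using key[of A C] key[of C A] AB BC
    by (auto simp: aw_near_def)
qed

lemma aw_limit_iff:
  "(\<exists>F. range F \<subseteq> \<S> \<and> aw_converges F A) \<longleftrightarrow> (\<forall>r>0. \<forall>e>0. \<exists>S\<in>\<S>. aw_near r e S A)"
proof
  assume "\<exists>F. range F \<subseteq> \<S> \<and> aw_converges F A"
  then obtain F where F: "range F \<subseteq> \<S>" "aw_converges F A" by blast
  show "\<forall>r>0. \<forall>e>0. \<exists>S\<in>\<S>. aw_near r e S A"
  proof (intro allI impI)
    fix r e :: real assume "r > 0" "e > 0"
    then have "\<forall>\<^sub>F i in sequentially. aw_near r e (F i) A"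
      using F by (simp add: aw_converges_iff_near)
    then obtain i where "aw_near r e (F i) A"
      by (metis eventually_happens sequentially_bot)
    then show "\<exists>S\<in>\<S>. aw_near r e S A" using F by blast
  qed
next
  assume *: "\<forall>r>0. \<forall>e>0. \<exists>S\<in>\<S>. aw_near r e S A"
  have "\<forall>i::nat. \<exists>S. S \<in> \<S> \<and> aw_near (real (Suc i)) (inverse (real (Suc i))) S A"
    using * by (meson inverse_positive_iff_positive of_nat_0_less_iff zero_less_Suc)
  then obtain F where F: "\<And>i::nat. F i \<in> \<S>"
      "\<And>i. aw_near (real (Suc i)) (inverse (real (Suc i))) (F i) A"
    by metis
  have "aw_converges F A"
    unfolding aw_converges_iff_near
  proof (intro allI impI)
    fix r e :: real assume "r > 0" "e > 0"
    have "\<forall>\<^sub>F i in sequentially. inverse (real (Suc i)) < e"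
      using order_tendstoD(2)[OF LIMSEQ_inverse_real_of_nat \<open>e > 0\<close>] .
    moreover have "\<forall>\<^sub>F i in sequentially. nat \<lceil>r\<rceil> \<le> i"
      by (rule eventually_ge_at_top)
    ultimately show "\<forall>\<^sub>F i in sequentially. aw_near r e (F i) A"
    proof eventually_elim
      case (elim i)
      then have "r \<le> real (Suc i)" by linarith
      with elim show ?case using aw_near_mono[OF F(2)] by (meson less_imp_le)
    qed
  qed
  then show "\<exists>F. range F \<subseteq> \<S> \<and> aw_converges F A" using F(1) by blast
qed

lemma aw_closure_sequential:
  assumes S: "\<S> \<subseteq> closed_sets0"
  shows "aw_closure \<S> = {A \<in> closed_sets0. \<exists>F. range F \<subseteq> \<S> \<and> aw_converges F A}"
    (is "_ = ?C")
proof
  have refl: "aw_near r e A A" if "e > 0" for r e and A :: "'a set"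
    using that by (auto simp: aw_near_def)
  have "openin aw_topology (closed_sets0 - ?C)"
    unfolding openin_aw_topology
  proof (intro conjI ballI allI impI)
    fix A F assume A: "A \<in> closed_sets0 - ?C" and F: "range F \<subseteq> closed_sets0 \<and> aw_converges F A"
    then obtain r e where re: "r > 0" "e > 0" "\<And>S. S \<in> \<S> \<Longrightarrow> \<not> aw_near r e S A"
      unfolding aw_limit_iff by blast
    define d where "d = min 1 (e / 2)"
    have d: "d > 0" "d \<le> 1" "2 * d \<le> e" using re by (auto simp: d_def)
    have "\<forall>\<^sub>F i in sequentially. aw_near (r + 1) d (F i) A"
      using F re d by (simp add: aw_converges_iff_near)
    then show "\<forall>\<^sub>F i in sequentially. F i \<in> closed_sets0 - ?C"
    proof eventually_elim
      case (elim i)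
      have Fi: "F i \<in> closed_sets0" using F by blast
      have "F i \<notin> ?C"
      proof
        assume "F i \<in> ?C"
        moreover have "r + 1 > 0" using re by simp
        ultimately obtain S where "S \<in> \<S>" "aw_near (r + 1) d S (F i)"
          unfolding aw_limit_iff using d by blast
        then have "aw_near r (2 * d) S A"
          using aw_near_trans elim d Fi by blast
        then show False using re(3) \<open>S \<in> \<S>\<close> d aw_near_mono by blast
      qed
      then show ?case using Fi by blast
    qed
  qed blast
  then have "closedin aw_topology ?C"
    by (auto simp: closedin_def topspace_aw_topology)
  moreover have "\<S> \<subseteq> ?C"
  proof
    fix A assume A: "A \<in> \<S>"
    then have "\<forall>r>0. \<forall>e>0. \<exists>S\<in>\<S>. aw_near r e S A" using refl by (metis (full_types))
    then show "A \<in> ?C" using A S unfolding aw_limit_iff by blast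
  qed
  ultimately show "aw_closure \<S> \<subseteq> ?C" by (simp add: closure_of_minimal)
  show "?C \<subseteq> aw_closure \<S>"
  proof
    fix A assume "A \<in> ?C"
    then obtain F where A: "A \<in> closed_sets0" and F: "range F \<subseteq> \<S>" "aw_converges F A" by blast
    show "A \<in> aw_closure \<S>"
      unfolding in_closure_of topspace_aw_topology
    proof (intro conjI allI impI)
      show "A \<in> closed_sets0" by fact
    next
      fix U assume "A \<in> U \<and> openin aw_topology U"
      then have "\<forall>\<^sub>F i in sequentially. F i \<in> U"
        using F S unfolding openin_aw_topology by blast
      then obtain i where "F i \<in> U" by (metis eventually_happens sequentially_bot)
      then show "\<exists>y. y \<in> \<S> \<and> y \<in> U" using F by blast
    qed
  qed
qed

lemma limitin_aw_topology:
  assumes F: "range F \<subseteq> closed_sets0" and A: "A \<in> closed_sets0"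
  shows "limitin aw_topology F A sequentially \<longleftrightarrow> aw_converges F A"
proof
  assume "aw_converges F A"
  then show "limitin aw_topology F A sequentially"
    using F A unfolding limitin_def topspace_aw_topology openin_aw_topology by blast
next
  assume lim: "limitin aw_topology F A sequentially"
  show "aw_converges F A"
    unfolding aw_converges_iff_near
  proof (intro allI impI)
    fix r e :: real assume re: "r > 0" "e > 0"
    define \<S> where "\<S> = {S \<in> closed_sets0. \<not> aw_near r e S A}"
    have S: "\<S> \<subseteq> closed_sets0" by (auto simp: \<S>_def)
    have "A \<notin> aw_closure \<S>"
      unfolding aw_closure_sequential[OF S] aw_limit_iff using re by (auto simp: \<S>_def)
    moreover have "openin aw_topology (closed_sets0 - aw_closure \<S>)"
      using closedin_closure_of[of aw_topology \<S>]
      by (metis closedin_def topspace_aw_topology)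
    ultimately have "\<forall>\<^sub>F i in sequentially. F i \<in> closed_sets0 - aw_closure \<S>"
      using lim A by (auto simp: limitin_def)
    moreover have "\<S> \<subseteq> aw_closure \<S>"
      by (simp add: S closure_of_subset topspace_aw_topology)
    ultimately show "\<forall>\<^sub>F i in sequentially. aw_near r e (F i) A"
      by (auto simp: \<S>_def elim!: eventually_mono)
  qed
qed

end

theory Submission
  imports Defs "HOL-Library.Diagonal_Subsequence"
begin

text \<open>Fix \<open>x \<in> A\<close> and let \<open>B = closure A - x\<close>, so that \<open>Tan (closure A) x\<close> consists of the limits
  of the blow-ups \<open>B / r\<close> as \<open>r\<close> tends to \<open>0\<close>. How well \<open>B\<close> is approximated by a local approximation class
  at scale \<open>r\<close> is the same as how well \<open>B / r\<close> is approximated at scale \<open>1\<close>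
  (\<open>approximable_blow_up\<close>), and this passes to limits of blow-ups and back, at the cost of a factor
  in the error and in the radius (\<open>approximable_limit\<close>). A set lies in the closure of the class
  exactly if it is approximable at every scale with every error
  (\<open>aw_closure_iff_approximable\<close>). Since \<open>A\<close> is well approximated by \<open>\<S>\<close> at small scales, all
  tangent sets are in the closure of \<open>\<S>\<close>.

  The points of \<open>A\<close> are divided according to whether or not some tangent set at \<open>x\<close> belongs to the
  closure of \<open>\<T>\<close>, and the theorem says that there is no mixed behaviour.

  If one tangent set is in the closure of \<open>\<T>\<close>, then so are all
  (\<open>Tan_subset_aw_closure_if_meets\<close>). This is a connectedness argument over the scales. Call a
  scale good if \<open>B\<close> is approximable by \<open>\<T>\<close> there with a fixed error below the
  separation constant. The tangent set in the closure of \<open>\<T>\<close> gives arbitrarily long runs of good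
  scales; a tangent set outside it gives, by separation at infinity, arbitrarily small bad scales.
  Descending from the top of a long good run to the first bad scale \<open>t\<close>, the blow-ups \<open>B / t\<close> have a
  limit \<open>E\<close>, which is approximable at all large scales. Separation at infinity puts \<open>E\<close> into
  the closure of \<open>\<T>\<close>, so \<open>E\<close> is approximable with arbitrarily small error near scale \<open>1\<close> too,
  which contradicts the badness of \<open>t\<close>.

  If no tangent set is in the closure of \<open>\<T>\<close>, then all are singular
  (\<open>Tan_subset_singular_class_if_disjoint\<close>): a tangent set that is approximable with arbitrarily
  small error along scales tending to \<open>0\<close> makes \<open>B\<close> approximable at small scales \<open>\<sigma>\<close> with tiny
  error, and blowing up \<open>B\<close> at scales much smaller than \<open>\<sigma>\<close> produces a tangent set that is
  approximable at every scale, hence one in the closure of \<open>\<T>\<close>.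

  The limits of blow-ups exist because the closed sets containing \<open>0\<close> are sequentially compact
  (\<open>aw_convergent_subsequence\<close>).\<close>

section \<open>Attouch--Wets closeness, scaling and sequential compactness\<close>

lemma aw_near_sym: "aw_near r e A B \<Longrightarrow> aw_near r e B A"
  by (auto simp: aw_near_def)

text \<open>Each radius is enlarged only by the error of the other comparison. Unlike \<open>aw_near_trans\<close>, this
  allows the two errors to differ, which matters because one of them will be proportional to the
  radius and the other arbitrarily small.\<close>

lemma aw_near_compose:
  assumes AB: "aw_near (r + d) e A B" and BC: "aw_near (r + e) d B C"
    and B: "B \<in> closed_sets0" and "0 \<le> d" "0 \<le> e"
  shows "aw_near r (d + e) A C"
proof -
  have B': "closed B" "B \<noteq> {}" using B by (auto simp: closed_sets0_def)
  have key: "infdist a Y \<le> p + q"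
    if "\<And>a. a \<in> X \<Longrightarrow> norm a \<le> r + p \<Longrightarrow> infdist a B \<le> q"
      and "\<And>b. b \<in> B \<Longrightarrow> norm b \<le> r + q \<Longrightarrow> infdist b Y \<le> p"
      and "a \<in> X" "norm a \<le> r" "0 \<le> p" "0 \<le> q" for X Y :: "'a set" and a p q
  proof -
    obtain b where b: "b \<in> B" "infdist a B = dist a b"
      using infdist_attains_inf[OF B'] by blast
    have "dist a b \<le> q" using that(1)[of a] that(3-6) b(2) by simp
    moreover have "norm b \<le> norm a + dist a b"
      by (metis add.commute dist_commute dist_norm norm_triangle_sub)
    ultimately have "infdist b Y \<le> p" using that(4) b(1) by (intro that(2)) linarith+
    with infdist_triangle[of a Y b] \<open>dist a b \<le> q\<close> show ?thesis by linarith
  qed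
  show ?thesis
    unfolding aw_near_def
  proof safe
    fix a assume "a \<in> A" "a \<in> cball 0 r"
    then show "infdist a C \<le> d + e"
      using AB BC assms(4,5) by (intro key[of A d e C]) (auto simp: aw_near_def)
  next
    fix a assume "a \<in> C" "a \<in> cball 0 r"
    then have "infdist a A \<le> e + d"
      using AB BC assms(4,5) by (intro key[of C e d A]) (auto simp: aw_near_def)
    then show "infdist a A \<le> d + e" by simp
  qed
qed

definition blow_up :: "real \<Rightarrow> 'a::euclidean_space set \<Rightarrow> 'a set" where
  "blow_up r A = (\<lambda>y. y /\<^sub>R r) ` A"

lemma blow_up_blow_up: "blow_up r (blow_up s A) = blow_up (r * s) A"
  by (auto simp: blow_up_def image_image mult.commute)

lemma blow_up_1 [simp]: "blow_up 1 A = A"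
  by (simp add: blow_up_def)

lemma blow_up_closed_sets0:
  assumes "A \<in> closed_sets0"
  shows "blow_up r A \<in> closed_sets0"
proof -
  have "closed (blow_up r A)"
    unfolding blow_up_def using assms by (intro closed_scaling) (auto simp: closed_sets0_def)
  moreover have "0 \<in> blow_up r A"
    using assms by (auto simp: blow_up_def closed_sets0_def image_iff intro!: bexI[of _ 0])
  ultimately show ?thesis by (simp add: closed_sets0_def)
qed

lemma local_approx_class_blow_up:
  assumes "local_approx_class \<T>" "T \<in> \<T>" "r > 0"
  shows "blow_up r T \<in> \<T>"
  using assms by (auto simp: local_approx_class_def blow_up_def)

lemma infdist_blow_up:
  assumes "r > 0"
  shows "infdist (a /\<^sub>R r) (blow_up r B) = infdist a B / r"
proof (cases "B = {}")
  case True then show ?thesis by (simp add: blow_up_def infdist_def)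
next
  case False
  have le: "infdist (a /\<^sub>R r) (blow_up r B) \<le> infdist a B / r"
    if "r > 0" "B \<noteq> {}" for r and a :: 'a and B
  proof -
    have "infdist (a /\<^sub>R r) (blow_up r B) * r \<le> infdist a B"
      unfolding infdist_notempty[OF \<open>B \<noteq> {}\<close>]
    proof (rule cINF_greatest[OF that(2)])
      fix b assume "b \<in> B"
      then have "infdist (a /\<^sub>R r) (blow_up r B) \<le> dist (a /\<^sub>R r) (b /\<^sub>R r)"
        by (intro infdist_le) (auto simp: blow_up_def)
      also have "\<dots> = norm ((a - b) /\<^sub>R r)"
        by (simp only: dist_norm scaleR_diff_right)
      also have "\<dots> = dist a b / r"
        using \<open>r > 0\<close> by (simp add: dist_norm divide_inverse mult.commute)
      finally show "infdist (a /\<^sub>R r) (blow_up r B) * r \<le> dist a b"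
        using \<open>r > 0\<close> by (simp add: pos_le_divide_eq)
    qed
    then show ?thesis using \<open>r > 0\<close> by (simp add: pos_le_divide_eq)
  qed
  have "infdist (a /\<^sub>R r /\<^sub>R inverse r) (blow_up (inverse r) (blow_up r B))
      \<le> infdist (a /\<^sub>R r) (blow_up r B) / inverse r"
    using assms False by (intro le) (auto simp: blow_up_def)
  then have "infdist a B \<le> infdist (a /\<^sub>R r) (blow_up r B) * r"
    using assms by (simp add: blow_up_blow_up divide_inverse)
  then have "infdist a B / r \<le> infdist (a /\<^sub>R r) (blow_up r B)"
    using assms by (simp add: pos_divide_le_eq)
  then show ?thesis using le[OF assms False, of a] by simp
qed

lemma aw_near_blow_up:
  assumes "s > 0"
  shows "aw_near r e (blow_up s A) (blow_up s B) \<longleftrightarrow> aw_near (r * s) (e * s) A B"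
proof -
  have "norm (a /\<^sub>R s) \<le> r \<longleftrightarrow> norm a \<le> r * s" for a :: 'a
    using assms by (simp add: field_simps)
  moreover have "infdist (a /\<^sub>R s) (blow_up s X) \<le> e \<longleftrightarrow> infdist a X \<le> e * s" for a :: 'a and X
    using assms by (simp add: infdist_blow_up pos_divide_le_eq)
  ultimately have *: "(\<forall>a\<in>blow_up s X \<inter> cball 0 r. infdist a (blow_up s Y) \<le> e) \<longleftrightarrow>
      (\<forall>a\<in>X \<inter> cball 0 (r * s). infdist a Y \<le> e * s)" for X Y :: "'a set"
    unfolding blow_up_def[of s X] by fastforce
  show ?thesis unfolding aw_near_def * ..
qed

text \<open>For a single \<open>U n\<close>, either all but finitely many \<open>F i\<close> miss it or infinitely many meet it;
  a diagonal subsequence treats all \<open>n\<close> at once.\<close>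

lemma subsequence_hits_or_misses:
  fixes F :: "nat \<Rightarrow> 'a set" and U :: "nat \<Rightarrow> 'a set"
  obtains k where "strict_mono k"
    "\<And>n. (\<forall>\<^sub>F i in sequentially. F (k i) \<inter> U n \<noteq> {}) \<or> (\<forall>\<^sub>F i in sequentially. F (k i) \<inter> U n = {})"
proof -
  define P where "P n s \<longleftrightarrow> (\<forall>\<^sub>F i in sequentially. F (s i) \<inter> U n \<noteq> {}) \<or>
      (\<forall>\<^sub>F i in sequentially. F (s i) \<inter> U n = {})" for n and s :: "nat \<Rightarrow> nat"
  interpret subseqs P
  proof
    fix n and s :: "nat \<Rightarrow> nat" assume "strict_mono s"
    show "\<exists>r'. strict_mono r' \<and> P n (s \<circ> r')"
    proof (cases "\<forall>\<^sub>F i in sequentially. F (s i) \<inter> U n = {}")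
      case True
      then have "strict_mono (id :: nat \<Rightarrow> nat) \<and> P n (s \<circ> id)"
        by (auto simp: P_def strict_mono_def)
      then show ?thesis by blast
    next
      case False
      then have "infinite {i. F (s i) \<inter> U n \<noteq> {}}"
        by (simp add: eventually_sequentially infinite_nat_iff_unbounded_le)
      from infinite_enumerate[OF this] obtain r' :: "nat \<Rightarrow> nat"
        where r': "strict_mono r'" "\<And>i. F (s (r' i)) \<inter> U n \<noteq> {}"
        by auto
      then have "P n (s \<circ> r')" by (simp add: P_def)
      with r'(1) show ?thesis by blast
    qed
  qed
  define k where "k = diagseq"
  have diag: "P n (k \<circ> (+) (Suc n))" for n
    unfolding k_def
  proof (rule diagseq_holds)
    fix r s :: "nat \<Rightarrow> nat" and n assume "strict_mono r" "P n s"
    then show "P n (s \<circ> r)"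
      unfolding P_def o_def using eventually_subseq by blast
  qed
  have shifted: "(\<forall>\<^sub>F i in sequentially. F (k (i + Suc n)) \<inter> U n \<noteq> {}) \<or>
      (\<forall>\<^sub>F i in sequentially. F (k (i + Suc n)) \<inter> U n = {})" for n
    using diag[of n] unfolding P_def o_def by (simp only: add.commute[of "Suc n"])
  have "(\<forall>\<^sub>F i in sequentially. F (k i) \<inter> U n \<noteq> {}) \<or>
      (\<forall>\<^sub>F i in sequentially. F (k i) \<inter> U n = {})" for n
    using shifted[of n]
    unfolding eventually_sequentially_seg[of "\<lambda>i. F (k i) \<inter> U n \<noteq> {}"]
      eventually_sequentially_seg[of "\<lambda>i. F (k i) \<inter> U n = {}"] .
  with subseq_diagseq show thesis unfolding k_def[symmetric] by (rule that)
qed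

text \<open>Along a subsequence that meets or misses each set of a countable base, the set \<open>E\<close> of
  points all of whose basic neighbourhoods are eventually met is the limit: a bounded region is
  covered by finitely many small basic sets, and a basic set that is eventually met has a point of
  \<open>E\<close> in its closure by compactness.\<close>

lemma aw_convergent_subsequence:
  fixes F :: "nat \<Rightarrow> 'a::euclidean_space set"
  assumes F: "\<And>i. F i \<in> closed_sets0"
  obtains k E where "strict_mono k" "E \<in> closed_sets0" "aw_converges (\<lambda>i. F (k i)) E"
proof -
  obtain \<B> :: "'a set set" where \<B>: "countable \<B>" "topological_basis \<B>"
    using ex_countable_basis by blast
  have "\<B> \<noteq> {}"
  proof
    assume "\<B> = {}"
    with topological_basisE[OF \<B>(2), of UNIV "0::'a"] show False by auto
  qed
  then have range: "range (from_nat_into \<B>) = \<B>"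
    using \<B> by (rule_tac range_from_nat_into)
  obtain k where k: "strict_mono k"
    and dich: "\<And>n. (\<forall>\<^sub>F i in sequentially. F (k i) \<inter> from_nat_into \<B> n \<noteq> {}) \<or>
      (\<forall>\<^sub>F i in sequentially. F (k i) \<inter> from_nat_into \<B> n = {})"
    using subsequence_hits_or_misses[of F "from_nat_into \<B>"] by blast
  define G where "G i = F (k i)" for i
  have G: "closed (G i)" "0 \<in> G i" for i
    using F by (auto simp: G_def closed_sets0_def)
  have dich: "(\<forall>\<^sub>F i in sequentially. G i \<inter> U \<noteq> {}) \<or> (\<forall>\<^sub>F i in sequentially. G i \<inter> U = {})"
    if "U \<in> \<B>" for U
  proof -
    have "U \<in> range (from_nat_into \<B>)" unfolding range by fact
    then obtain n where "U = from_nat_into \<B> n" by (rule rangeE)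
    with dich[of n] show ?thesis by (simp add: G_def)
  qed
  define E where "E = {x. \<forall>U\<in>\<B>. x \<in> U \<longrightarrow> (\<forall>\<^sub>F i in sequentially. G i \<inter> U \<noteq> {})}"
  have "0 \<in> E" unfolding E_def using G(2) by (auto intro!: always_eventually)
  have "open (- E)"
  proof (subst open_subopen, safe)
    fix x assume "x \<notin> E"
    then obtain U where "U \<in> \<B>" "x \<in> U" "\<not> (\<forall>\<^sub>F i in sequentially. G i \<inter> U \<noteq> {})"
      by (auto simp: E_def)
    then show "\<exists>T. open T \<and> x \<in> T \<and> T \<subseteq> - E"
      using topological_basis_open[OF \<B>(2)] by (intro exI[of _ U]) (auto simp: E_def)
  qed
  then have E: "E \<in> closed_sets0"
    using \<open>0 \<in> E\<close> by (simp add: closed_sets0_def closed_def)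
  have hit: "\<exists>x\<in>E. x \<in> closure U"
    if U: "U \<in> \<B>" "bounded U" "\<forall>\<^sub>F i in sequentially. G i \<inter> U \<noteq> {}" for U
  proof -
    have "\<forall>i. \<exists>a. G i \<inter> U \<noteq> {} \<longrightarrow> a \<in> G i \<inter> U" by blast
    then obtain a where a: "\<And>i. G i \<inter> U \<noteq> {} \<Longrightarrow> a i \<in> G i \<inter> U" by metis
    from U(3) obtain N where N: "\<And>i. i \<ge> N \<Longrightarrow> G i \<inter> U \<noteq> {}"
      by (auto simp: eventually_sequentially)
    have "compact (closure U)" using U by simp
    moreover have "a (i + N) \<in> closure U" for i
      using a[OF N[of "i + N"]] closure_subset[of U] by auto
    ultimately obtain x r where x: "x \<in> closure U" and r: "strict_mono (r :: nat \<Rightarrow> nat)"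
      and lim: "((\<lambda>i. a (i + N)) \<circ> r) \<longlonglongrightarrow> x"
      using seq_compactE[of "closure U" "\<lambda>i. a (i + N)"] compact_imp_seq_compact by blast
    have "x \<in> E"
      unfolding E_def
    proof (safe, rule ccontr)
      fix V assume V: "V \<in> \<B>" "x \<in> V" and "\<not> (\<forall>\<^sub>F i in sequentially. G i \<inter> V \<noteq> {})"
      with dich have miss: "\<forall>\<^sub>F i in sequentially. G i \<inter> V = {}" by blast
      have "filterlim (\<lambda>i. r i + N) at_top sequentially"
        using filterlim_subseq[OF r] by (intro filterlim_compose[OF filterlim_add_const_nat_at_top])
      with miss have "\<forall>\<^sub>F i in sequentially. G (r i + N) \<inter> V = {}"
        by (rule eventually_compose_filterlim)
      moreover have "\<forall>\<^sub>F i in sequentially. a (r i + N) \<in> V"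
        using topological_tendstoD[OF lim] V topological_basis_open[OF \<B>(2)] by (simp add: o_def)
      ultimately have "\<forall>\<^sub>F i in sequentially. False"
      proof eventually_elim
        case (elim i)
        with a[OF N, of "r i + N"] show False by auto
      qed
      then show False by simp
    qed
    with x show ?thesis by blast
  qed
  have "aw_converges G E"
    unfolding aw_converges_iff_near
  proof (intro allI impI)
    fix r e :: real assume "r > 0" "e > 0"
    define \<U> where "\<U> = {U \<in> \<B>. \<exists>c. U \<subseteq> ball c (e / 2)}"
    have "cball (0::'a) r \<subseteq> \<Union>\<U>"
    proof
      fix x :: 'a
      obtain U where "U \<in> \<B>" "x \<in> U" "U \<subseteq> ball x (e / 2)"
        using topological_basisE[OF \<B>(2), of "ball x (e / 2)" x] \<open>e > 0\<close> by auto
      then show "x \<in> \<Union>\<U>" by (auto simp: \<U>_def)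
    qed
    moreover have "\<And>U. U \<in> \<U> \<Longrightarrow> open U"
      using topological_basis_open[OF \<B>(2)] by (auto simp: \<U>_def)
    ultimately obtain \<V> where \<V>: "\<V> \<subseteq> \<U>" "finite \<V>" "cball 0 r \<subseteq> \<Union>\<V>"
      by (rule compactE[OF compact_cball])
    have close: "dist x y \<le> e" if "U \<in> \<U>" "x \<in> closure U" "y \<in> closure U" for U x y
    proof -
      from \<open>U \<in> \<U>\<close> obtain c where "U \<subseteq> ball c (e / 2)" by (auto simp: \<U>_def)
      then have "closure U \<subseteq> cball c (e / 2)"
        by (meson ball_subset_cball closed_cball closure_minimal order_trans)
      then have "dist c x \<le> e / 2" "dist c y \<le> e / 2" using that by auto
      then show ?thesis using dist_triangle3[of x y c] by simp
    qed
    have "\<forall>\<^sub>F i in sequentially. (E \<inter> U \<noteq> {} \<longrightarrow> G i \<inter> U \<noteq> {}) \<and>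
        (G i \<inter> U \<noteq> {} \<longrightarrow> E \<inter> closure U \<noteq> {})" if "U \<in> \<V>" for U
    proof -
      from that \<V>(1) obtain c where "U \<in> \<B>" "U \<subseteq> ball c (e / 2)" by (auto simp: \<U>_def)
      then have UB: "U \<in> \<B>" "bounded U" using bounded_subset[OF bounded_ball] by auto
      from dich[OF this(1)] show ?thesis
      proof
        assume U: "\<forall>\<^sub>F i in sequentially. G i \<inter> U \<noteq> {}"
        then show ?thesis
        proof eventually_elim
          case (elim i)
          with hit[OF UB U] show ?case by blast
        qed
      next
        assume U: "\<forall>\<^sub>F i in sequentially. G i \<inter> U = {}"
        have "E \<inter> U = {}"
        proof (rule ccontr)
          assume "E \<inter> U \<noteq> {}"
          then obtain x where "x \<in> E" "x \<in> U" by blast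
          then have "\<forall>\<^sub>F i in sequentially. G i \<inter> U \<noteq> {}" using UB(1) unfolding E_def by blast
          with U have "\<forall>\<^sub>F i in sequentially. False" by eventually_elim simp
          then show False by simp
        qed
        from U show ?thesis
        proof eventually_elim
          case (elim i)
          with \<open>E \<inter> U = {}\<close> show ?case by simp
        qed
      qed
    qed
    then have "\<forall>\<^sub>F i in sequentially. \<forall>U\<in>\<V>. (E \<inter> U \<noteq> {} \<longrightarrow> G i \<inter> U \<noteq> {}) \<and>
        (G i \<inter> U \<noteq> {} \<longrightarrow> E \<inter> closure U \<noteq> {})"
      using \<V>(2) by (simp add: eventually_ball_finite_distrib)
    then show "\<forall>\<^sub>F i in sequentially. aw_near r e (G i) E"
    proof eventually_elim
      case (elim i)
      have key: "infdist a Y \<le> e"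
        if "a \<in> X" "a \<in> cball 0 r" "\<And>U. U \<in> \<V> \<Longrightarrow> X \<inter> U \<noteq> {} \<Longrightarrow> Y \<inter> closure U \<noteq> {}" for a X Y
      proof -
        from \<V>(3) \<open>a \<in> cball 0 r\<close> obtain U where U: "U \<in> \<V>" "a \<in> U" by blast
        then have "Y \<inter> closure U \<noteq> {}" using that(1) by (intro that(3)) auto
        then obtain b where b: "b \<in> Y" "b \<in> closure U" by blast
        moreover have "a \<in> closure U" using U(2) closure_subset[of U] by blast
        ultimately have "dist a b \<le> e" using close[of U a b] U(1) \<V>(1) by blast
        with b show ?thesis by (intro infdist_le2)
      qed
      have "E \<inter> U \<noteq> {} \<Longrightarrow> G i \<inter> closure U \<noteq> {}" if "U \<in> \<V>" for U
        using elim that closure_subset[of U] by blast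
      then show ?case
        unfolding aw_near_def
      proof safe
        fix a assume "a \<in> G i" "a \<in> cball 0 r"
        then show "infdist a E \<le> e" by (intro key[of a "G i" E]) (use elim in blast)+
      next
        fix a assume "a \<in> E" "a \<in> cball 0 r"
        then show "infdist a (G i) \<le> e"
          using \<open>\<And>U. U \<in> \<V> \<Longrightarrow> E \<inter> U \<noteq> {} \<Longrightarrow> G i \<inter> closure U \<noteq> {}\<close>
          by (intro key[of a E "G i"])
      qed
    qed
  qed
  with k E show thesis unfolding G_def[abs_def] by (rule that)
qed

section \<open>Approximability at one scale\<close>

text \<open>The existence of a witness replaces the infimum \<open>approximability \<T> D 0 r\<close>: for
  \<open>r > 0\<close>, comparing the latter with \<open>\<delta>\<close> differs only in the case of equality with \<open>\<delta>\<close>.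
  The error is relative to the radius, which makes the notion scale-invariant.\<close>

definition approximable :: "'a::euclidean_space set set \<Rightarrow> real \<Rightarrow> real \<Rightarrow> 'a set \<Rightarrow> bool" where
  "approximable \<T> \<delta> r D \<longleftrightarrow> (\<exists>T\<in>\<T>. aw_near r (\<delta> * r) D T)"

lemma approximable_mono:
  assumes "approximable \<T> \<delta> r D" "r' \<le> r" "\<delta> * r \<le> \<delta>' * r'"
  shows "approximable \<T> \<delta>' r' D"
  using assms aw_near_mono unfolding approximable_def by blast

lemma rel_dist_le_iff:
  assumes "r > 0" "0 \<le> \<delta>"
  shows "rel_dist x r A B \<le> ennreal \<delta> \<longleftrightarrow>
    (\<forall>a\<in>A \<inter> cball x r. infdist a B \<le> \<delta> * r) \<and> (\<forall>b\<in>B \<inter> cball x r. infdist b A \<le> \<delta> * r)"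
proof -
  have *: "z / ennreal r \<le> ennreal \<delta> \<longleftrightarrow> z \<le> ennreal (\<delta> * r)" for z
  proof
    assume "z / ennreal r \<le> ennreal \<delta>"
    then have "z / ennreal r * ennreal r \<le> ennreal \<delta> * ennreal r" by (rule mult_right_mono) simp
    also have "z / ennreal r * ennreal r = z"
      using assms by (simp add: ennreal_divide_times ennreal_divide_self)
    finally show "z \<le> ennreal (\<delta> * r)" using assms by (simp add: ennreal_mult)
  next
    assume "z \<le> ennreal (\<delta> * r)"
    then have "z / ennreal r \<le> ennreal (\<delta> * r) / ennreal r" by (rule divide_right_mono_ennreal)
    also have "\<dots> = ennreal \<delta>" using assms by (simp add: divide_ennreal)
    finally show "z / ennreal r \<le> ennreal \<delta>" .
  qed
  show ?thesis
    unfolding rel_dist_def * using assms by (simp add: excess_le_iff)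
qed

lemma infdist_translate: "infdist (a - x) ((\<lambda>y. y - x) ` B) = infdist a (B :: 'a::euclidean_space set)"
  by (simp add: infdist_def image_image dist_norm)

lemma approximability_less_imp:
  assumes "approximability \<T> A x r < ennreal \<delta>" "r > 0"
  shows "approximable \<T> \<delta> r ((\<lambda>y. y - x) ` A)"
proof -
  have "\<delta> > 0" using assms by (metis ennreal_eq_0_iff linorder_not_le not_less_zero)
  obtain T where T: "T \<in> \<T>" "rel_dist x r A ((+) x ` T) \<le> ennreal \<delta>"
    using assms by (auto simp: approximability_def INF_less_iff intro: less_imp_le)
  have T': "(\<lambda>y. y - x) ` (+) x ` T = T" by (auto simp: image_image)
  have key: "\<forall>a\<in>(\<lambda>y. y - x) ` X \<inter> cball 0 r. infdist a ((\<lambda>y. y - x) ` Y) \<le> \<delta> * r"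
    if "\<forall>a\<in>X \<inter> cball x r. infdist a Y \<le> \<delta> * r" for X Y
    using that by (auto simp: infdist_translate dist_norm norm_minus_commute)
  have "aw_near r (\<delta> * r) ((\<lambda>y. y - x) ` A) T"
    unfolding aw_near_def using T(2) \<open>\<delta> > 0\<close> \<open>r > 0\<close> key[of A "(+) x ` T"] key[of "(+) x ` T" A]
    by (simp add: rel_dist_le_iff T')
  with T show ?thesis by (auto simp: approximable_def)
qed

lemma approximable_imp_approximability_le:
  assumes "approximable \<T> \<delta> r D" "r > 0" "0 \<le> \<delta>"
  shows "approximability \<T> D 0 r \<le> ennreal \<delta>"
proof -
  obtain T where "T \<in> \<T>" "aw_near r (\<delta> * r) D T"
    using assms by (auto simp: approximable_def)
  then have "rel_dist 0 r D ((+) 0 ` T) \<le> ennreal \<delta>"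
    using assms by (simp add: rel_dist_le_iff aw_near_def)
  with \<open>T \<in> \<T>\<close> show ?thesis
    unfolding approximability_def by (rule INF_lower2)
qed

text \<open>Approximating sets can be rescaled along with \<open>D\<close>, since \<open>\<T>\<close> is closed under dilations.\<close>

lemma approximable_blow_up:
  assumes \<T>: "local_approx_class \<T>" and "s > 0"
  shows "approximable \<T> \<delta> r (blow_up s D) \<longleftrightarrow> approximable \<T> \<delta> (r * s) D"
proof -
  have *: "aw_near r (\<delta> * r) (blow_up s D) (blow_up s T) \<longleftrightarrow> aw_near (r * s) (\<delta> * (r * s)) D T" for T
    using aw_near_blow_up[OF \<open>s > 0\<close>, of r "\<delta> * r" D T] by (simp add: mult.assoc)
  show ?thesis
  proof
    assume "approximable \<T> \<delta> (r * s) D"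
    then show "approximable \<T> \<delta> r (blow_up s D)"
      using local_approx_class_blow_up[OF \<T> _ \<open>s > 0\<close>] unfolding approximable_def
      by (metis *)
  next
    assume "approximable \<T> \<delta> r (blow_up s D)"
    then obtain T where T: "T \<in> \<T>" "aw_near r (\<delta> * r) (blow_up s D) T"
      by (auto simp: approximable_def)
    have "T = blow_up s (blow_up (inverse s) T)"
      using \<open>s > 0\<close> by (simp add: blow_up_blow_up)
    with T(2) have "aw_near (r * s) (\<delta> * (r * s)) D (blow_up (inverse s) T)"
      using * by metis
    then show "approximable \<T> \<delta> (r * s) D"
      using local_approx_class_blow_up[OF \<T> T(1), of "inverse s"] \<open>s > 0\<close>
      by (auto simp: approximable_def)
  qed
qed

text \<open>Passing from \<open>D'\<close> to a nearby \<open>D\<close> adds the distance \<open>d\<close> to the error and subtracts it from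
  the radius. With \<open>d\<close> at most \<open>r / 2\<close> and \<open>\<delta> * r\<close>, the radius is halved and the error doubled at
  worst; relative to the new radius, the error is four times as large.\<close>

lemma approximable_transfer:
  assumes near: "aw_near (r * (1 + \<delta>)) d D D'" and D': "approximable \<T> \<delta> r D'" "D' \<in> closed_sets0"
    and d: "0 \<le> d" "d \<le> r / 2" "d \<le> \<delta> * r"
  shows "approximable \<T> (4 * \<delta>) (r / 2) D"
proof -
  obtain T where T: "T \<in> \<T>" "aw_near r (\<delta> * r) D' T"
    using D' by (auto simp: approximable_def)
  have "aw_near (r / 2) (\<delta> * r + d) D T"
  proof (rule aw_near_compose[OF _ _ D'(2)])
    have "r / 2 + \<delta> * r \<le> r * (1 + \<delta>)" using d by (simp add: algebra_simps)
    with near show "aw_near (r / 2 + \<delta> * r) d D D'" by (rule aw_near_mono) simp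
    show "aw_near (r / 2 + d) (\<delta> * r) D' T" using T(2) by (rule aw_near_mono) (use d in auto)
  qed (use d in auto)
  then have "aw_near (r / 2) (4 * \<delta> * (r / 2)) D T"
    by (rule aw_near_mono) (use d in auto)
  with T show ?thesis by (auto simp: approximable_def)
qed

lemma approximable_limit:
  assumes conv: "aw_converges F D" and F: "\<And>i. F i \<in> closed_sets0" and D: "D \<in> closed_sets0"
    and "\<delta> > 0" "r > 0"
  shows "\<forall>\<^sub>F i in sequentially.
     (approximable \<T> \<delta> r D \<longrightarrow> approximable \<T> (4 * \<delta>) (r / 2) (F i)) \<and>
     (approximable \<T> \<delta> r (F i) \<longrightarrow> approximable \<T> (4 * \<delta>) (r / 2) D)"
proof -
  define d where "d = min (r / 2) (\<delta> * r)"
  have d: "0 < d" "d \<le> r / 2" "d \<le> \<delta> * r" using assms by (auto simp: d_def)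
  have "\<forall>\<^sub>F i in sequentially. aw_near (r * (1 + \<delta>)) d (F i) D"
    using conv d assms by (simp add: aw_converges_iff_near)
  then show ?thesis
  proof eventually_elim
    case (elim i)
    then show ?case
      using approximable_transfer[OF elim _ D, of \<T>]
        approximable_transfer[OF aw_near_sym[OF elim] _ F, of \<T>] d by simp
  qed
qed

lemma aw_closure_iff_approximable:
  assumes \<T>: "local_approx_class \<T>"
  shows "D \<in> aw_closure \<T> \<longleftrightarrow> D \<in> closed_sets0 \<and> (\<forall>\<delta>>0. \<forall>r>0. approximable \<T> \<delta> r D)"
proof -
  have "(\<forall>r>0. \<forall>e>0. \<exists>T\<in>\<T>. aw_near r e T D) \<longleftrightarrow> (\<forall>\<delta>>0. \<forall>r>0. approximable \<T> \<delta> r D)"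
  proof safe
    fix \<delta> r :: real assume *: "\<forall>r>0. \<forall>e>0. \<exists>T\<in>\<T>. aw_near r e T D" "\<delta> > 0" "r > 0"
    then have "\<exists>T\<in>\<T>. aw_near r (\<delta> * r) T D" by simp
    then show "approximable \<T> \<delta> r D" unfolding approximable_def using aw_near_sym by blast
  next
    fix r e :: real assume *: "\<forall>\<delta>>0. \<forall>r>0. approximable \<T> \<delta> r D" "r > 0" "e > 0"
    then have "approximable \<T> (e / r) r D" by simp
    then show "\<exists>T\<in>\<T>. aw_near r e T D" unfolding approximable_def using aw_near_sym \<open>r > 0\<close> by fastforce
  qed
  moreover have "\<T> \<subseteq> closed_sets0" using \<T> by (auto simp: local_approx_class_def)
  ultimately show ?thesis by (simp add: aw_closure_sequential aw_limit_iff)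
qed

section \<open>Tangent sets\<close>

lemma Tan_eq_Tan_translate: "Tan A x = Tan ((\<lambda>y. y - x) ` A) 0"
  by (simp add: Tan_def image_image)

lemma TanE:
  assumes "D \<in> Tan B 0"
  obtains s where "\<And>i. s i > 0" "s \<longlonglongrightarrow> 0" "aw_converges (\<lambda>i. blow_up (s i) B) D" "D \<in> closed_sets0"
  using assms by (auto simp: Tan_def blow_up_def)

lemma Tan_of_blow_ups:
  fixes t :: "nat \<Rightarrow> real"
  assumes "B \<in> closed_sets0" "\<And>i. t i > 0" "t \<longlonglongrightarrow> 0"
  obtains k E where "strict_mono k" "E \<in> Tan B 0" "E \<in> closed_sets0"
    "aw_converges (\<lambda>i. blow_up (t (k i)) B) E"
proof -
  obtain k E where kE: "strict_mono k" "E \<in> closed_sets0" "aw_converges (\<lambda>i. blow_up (t (k i)) B) E"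
    using aw_convergent_subsequence[of "\<lambda>i. blow_up (t i) B"] assms blow_up_closed_sets0 by blast
  have "(t \<circ> k) \<longlonglongrightarrow> 0" using assms kE LIMSEQ_subseq_LIMSEQ by blast
  with kE assms have "E \<in> Tan B 0"
    unfolding Tan_def blow_up_def by (auto simp: o_def intro!: exI[of _ "t \<circ> k"])
  with kE show thesis using that by blast
qed

text \<open>Some arbitrarily small scale of \<open>B\<close> shows what \<open>D\<close> looks like at scale \<open>r\<close>. The
  first implication transfers good scales of \<open>D\<close> to \<open>B\<close>; the second, read backwards, does the same
  for bad scales.\<close>

lemma Tan_approximable:
  assumes \<T>: "local_approx_class \<T>" and B: "B \<in> closed_sets0" and D: "D \<in> Tan B 0"
    and "\<delta> > 0" "r > 0" "\<rho> > 0"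
  obtains s where "0 < s" "s < \<rho>"
    "approximable \<T> \<delta> r D \<Longrightarrow> approximable \<T> (4 * \<delta>) (r / 2 * s) B"
    "approximable \<T> \<delta> (r * s) B \<Longrightarrow> approximable \<T> (4 * \<delta>) (r / 2) D"
proof -
  obtain s where s: "\<And>i. s i > 0" "s \<longlonglongrightarrow> 0" "aw_converges (\<lambda>i. blow_up (s i) B) D"
    and D: "D \<in> closed_sets0" using TanE[OF D] by blast
  have "\<forall>\<^sub>F i in sequentially. s i < \<rho>" using order_tendstoD(2)[OF s(2) \<open>\<rho> > 0\<close>] .
  with approximable_limit[OF s(3) blow_up_closed_sets0[OF B] D \<open>\<delta> > 0\<close> \<open>r > 0\<close>, of \<T>]
  have "\<forall>\<^sub>F i in sequentially. s i < \<rho> \<and>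
     (approximable \<T> \<delta> r D \<longrightarrow> approximable \<T> (4 * \<delta>) (r / 2) (blow_up (s i) B)) \<and>
     (approximable \<T> \<delta> r (blow_up (s i) B) \<longrightarrow> approximable \<T> (4 * \<delta>) (r / 2) D)"
    by eventually_elim simp
  then obtain i where "s i < \<rho> \<and>
     (approximable \<T> \<delta> r D \<longrightarrow> approximable \<T> (4 * \<delta>) (r / 2) (blow_up (s i) B)) \<and>
     (approximable \<T> \<delta> r (blow_up (s i) B) \<longrightarrow> approximable \<T> (4 * \<delta>) (r / 2) D)"
    by (metis (mono_tags, lifting) eventually_happens sequentially_bot)
  with s(1)[of i] that show thesis
    by (auto simp: approximable_blow_up[OF \<T>])
qed

lemma Tan_subset_aw_closure:
  assumes \<S>: "local_approx_class \<S>" and B: "B \<in> closed_sets0"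
    and approx: "\<And>\<delta>. \<delta> > 0 \<Longrightarrow> \<exists>\<rho>>0. \<forall>r. 0 < r \<and> r < \<rho> \<longrightarrow> approximable \<S> \<delta> r B"
  shows "Tan B 0 \<subseteq> aw_closure \<S>"
proof
  fix D assume D: "D \<in> Tan B 0"
  have "approximable \<S> \<delta> r D" if "\<delta> > 0" "r > 0" for \<delta> r
  proof -
    obtain \<rho> where \<rho>: "\<rho> > 0" "\<And>r. 0 < r \<Longrightarrow> r < \<rho> \<Longrightarrow> approximable \<S> (\<delta> / 4) r B"
      using approx[of "\<delta> / 4"] \<open>\<delta> > 0\<close> by auto
    obtain s where "0 < s" "s < \<rho> / (2 * r)"
      "approximable \<S> (\<delta> / 4) (2 * r * s) B \<Longrightarrow> approximable \<S> (4 * (\<delta> / 4)) (2 * r / 2) D"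
      using Tan_approximable[OF \<S> B D, of "\<delta> / 4" "2 * r" "\<rho> / (2 * r)"] \<open>\<delta> > 0\<close> \<open>r > 0\<close> \<rho>(1)
      by auto
    then show ?thesis using \<rho>(2)[of "2 * r * s"] \<open>r > 0\<close> by (simp add: field_simps)
  qed
  then show "D \<in> aw_closure \<S>"
    using D TanE[OF D] by (auto simp: aw_closure_iff_approximable[OF \<S>])
qed

section \<open>The dichotomy for tangent sets\<close>

lemma separated_at_infinityE:
  assumes "separated_at_infinity \<T> \<R>"
  obtains \<phi> where "\<phi> > 0"
    "\<And>S R\<^sub>0. S \<in> \<R> \<Longrightarrow> S \<notin> aw_closure \<T> \<Longrightarrow> R\<^sub>0 > 0 \<Longrightarrow> \<exists>R>R\<^sub>0. \<not> approximable \<T> \<phi> R S"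
proof -
  obtain \<phi> :: real where \<phi>: "\<phi> > 0"
    "\<And>S. S \<in> \<R> - aw_closure \<T> \<Longrightarrow> ennreal \<phi> \<le> Limsup at_top (\<lambda>r. approximability \<T> S 0 r)"
    using assms by (auto simp: separated_at_infinity_def)
  show thesis
  proof (rule that[of "\<phi> / 2"], goal_cases)
    case (2 S R\<^sub>0)
    show ?case
    proof (rule ccontr)
      assume neg: "\<not> (\<exists>R>R\<^sub>0. \<not> approximable \<T> (\<phi> / 2) R S)"
      have "\<forall>\<^sub>F R in at_top. approximability \<T> S 0 R \<le> ennreal (\<phi> / 2)"
        using eventually_gt_at_top[of R\<^sub>0]
      proof eventually_elim
        case (elim R)
        then show ?case
          using neg \<phi>(1) 2 by (intro approximable_imp_approximability_le) auto
      qed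
      then have "Limsup at_top (\<lambda>r. approximability \<T> S 0 r) \<le> ennreal (\<phi> / 2)"
        by (rule Limsup_bounded)
      with \<phi>(2)[of S] 2 have "ennreal \<phi> \<le> ennreal (\<phi> / 2)" by (auto intro: order_trans)
      with \<phi>(1) show False by (simp add: ennreal_le_iff)
    qed
  qed (use \<phi> in simp)
qed

text \<open>The supremum of the bad scales up to \<open>r\<close> need not be bad itself, but some bad scale exceeds
  half of it. This is why the good run starts at \<open>2 * t\<close>.\<close>

lemma last_bad_scale:
  fixes r :: real
  assumes "\<not> N s" "0 < s" "s \<le> r"
  obtains t where "0 < t" "t \<le> r" "\<not> N t" "\<And>u. 2 * t \<le> u \<Longrightarrow> u \<le> r \<Longrightarrow> N u"
proof -
  define Z where "Z = {u. 0 < u \<and> u \<le> r \<and> \<not> N u}"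
  have Z: "s \<in> Z" "bdd_above Z" using assms by (auto simp: Z_def bdd_above_def)
  then have "0 < Sup Z" using cSup_upper[OF Z] \<open>0 < s\<close> by linarith
  then obtain t where t: "t \<in> Z" "Sup Z / 2 < t"
    using less_cSupD[of Z "Sup Z / 2"] Z by auto
  have "N u" if "2 * t \<le> u" "u \<le> r" for u
  proof (rule ccontr)
    assume "\<not> N u"
    then have "u \<in> Z" using t that by (auto simp: Z_def)
    then show False using cSup_upper[OF _ Z(2), of u] t that by simp
  qed
  then show thesis using that[of t] t by (auto simp: Z_def)
qed

text \<open>Blow-ups at the last bad scale below longer and longer runs of good scales converge to a set
  that is approximable at all large scales, but not with every error near scale \<open>1\<close>; separation at infinity forbids
  this.\<close>

lemma Tan_subset_aw_closure_if_meets: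
  assumes \<T>: "local_approx_class \<T>" and sep: "separated_at_infinity \<T> \<R>"
    and B: "B \<in> closed_sets0" and Tan: "Tan B 0 \<subseteq> \<R>"
    and meets: "Tan B 0 \<inter> aw_closure \<T> \<noteq> {}"
  shows "Tan B 0 \<subseteq> aw_closure \<T>"
proof (rule ccontr)
  assume "\<not> Tan B 0 \<subseteq> aw_closure \<T>"
  then obtain D where D: "D \<in> Tan B 0" "D \<notin> aw_closure \<T>" by blast
  obtain D\<^sub>0 where D\<^sub>0: "D\<^sub>0 \<in> Tan B 0" "D\<^sub>0 \<in> aw_closure \<T>" using meets by blast
  obtain \<phi> where \<phi>: "\<phi> > 0"
    "\<And>S R\<^sub>0. S \<in> \<R> \<Longrightarrow> S \<notin> aw_closure \<T> \<Longrightarrow> R\<^sub>0 > 0 \<Longrightarrow> \<exists>R>R\<^sub>0. \<not> approximable \<T> \<phi> R S"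
    using separated_at_infinityE[OF sep] by blast
  \<comment> \<open>passing to a limit multiplies the error by four, and the result must not exceed \<open>\<phi>\<close>\<close>
  define \<delta> where "\<delta> = \<phi> / 4"
  have \<delta>: "\<delta> > 0" "4 * \<delta> = \<phi>" using \<phi> by (auto simp: \<delta>_def)
  define N where "N u \<longleftrightarrow> approximable \<T> \<delta> u B" for u
  have good: "\<exists>r>0. r < \<rho> \<and> (\<forall>u. r / M \<le> u \<and> u \<le> r \<longrightarrow> N u)" if "M > 0" "\<rho> > 0" for M \<rho>
  proof -
    \<comment> \<open>error \<open>\<delta> / M\<close> at the top scale \<open>r\<close> is error at most \<open>\<delta>\<close> at all scales down to \<open>r / M\<close>\<close>
    have "approximable \<T> (\<delta> / (4 * M)) 2 D\<^sub>0"
      using D\<^sub>0 \<delta> \<open>M > 0\<close> by (simp add: aw_closure_iff_approximable[OF \<T>])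
    then obtain r where r: "0 < r" "r < \<rho>" "approximable \<T> (\<delta> / M) r B"
      using Tan_approximable[OF \<T> B D\<^sub>0(1), of "\<delta> / (4 * M)" 2 \<rho>] \<delta>(1) \<open>M > 0\<close> \<open>\<rho> > 0\<close>
      by auto
    have "N u" if "r / M \<le> u" "u \<le> r" for u
      unfolding N_def using r(3) that(2)
    proof (rule approximable_mono)
      show "\<delta> / M * r \<le> \<delta> * u" using mult_left_mono[OF that(1), of \<delta>] \<delta> by simp
    qed
    with r show ?thesis by blast
  qed
  have bad: "\<exists>s>0. s < \<rho> \<and> \<not> N s" if "\<rho> > 0" for \<rho>
  proof -
    obtain R where R: "R > 1" "\<not> approximable \<T> \<phi> R D" using \<phi>(2)[of D 1] D Tan by auto
    obtain s where s: "0 < s" "s < \<rho> / (2 * R)" "\<not> approximable \<T> \<delta> (2 * R * s) B"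
      using Tan_approximable[OF \<T> B D(1), of \<delta> "2 * R" "\<rho> / (2 * R)"] R \<delta> \<open>\<rho> > 0\<close> by auto
    then have "2 * R * s > 0" "2 * R * s < \<rho>" using R by (auto simp: field_simps)
    with s show ?thesis unfolding N_def by blast
  qed
  have "\<exists>r t. 0 < t \<and> t * real (Suc j) \<le> r \<and> r < inverse (real (Suc j)) \<and> \<not> N t \<and>
      (\<forall>u. 2 * t \<le> u \<and> u \<le> r \<longrightarrow> N u)" for j
  proof -
    obtain r where r: "r > 0" "r < inverse (real (Suc j))"
      "\<And>u. r / real (Suc j) \<le> u \<Longrightarrow> u \<le> r \<Longrightarrow> N u"
      using good[of "real (Suc j)" "inverse (real (Suc j))"] by auto
    obtain s where "s > 0" "s < r" "\<not> N s" using bad[OF r(1)] by blast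
    then obtain t where t: "0 < t" "t \<le> r" "\<not> N t" "\<And>u. 2 * t \<le> u \<Longrightarrow> u \<le> r \<Longrightarrow> N u"
      using last_bad_scale[of N s r] by auto
    \<comment> \<open>\<open>t\<close> is bad, so it lies below the whole good run\<close>
    then have "t < r / real (Suc j)" using r(3)[of t] by force
    then have "t * real (Suc j) \<le> r" by (simp add: field_simps del: of_nat_Suc)
    with r t show ?thesis by blast
  qed
  then obtain r t where rt: "\<And>j. 0 < t j" "\<And>j. t j * real (Suc j) \<le> r j"
    "\<And>j. r j < inverse (real (Suc j))" "\<And>j. \<not> N (t j)"
    "\<And>j u. 2 * t j \<le> u \<Longrightarrow> u \<le> r j \<Longrightarrow> N u" by metis
  have "t j \<le> inverse (real (Suc j))" for j
  proof -
    have "t j * 1 \<le> t j * real (Suc j)" using rt(1)[of j] by (intro mult_left_mono) auto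
    then show ?thesis using rt(2,3)[of j] by linarith
  qed
  then have "t \<longlonglongrightarrow> 0"
    using rt(1) by (intro tendsto_sandwich[OF _ _ tendsto_const LIMSEQ_inverse_real_of_nat])
      (auto simp: less_imp_le)
  then obtain k E where k: "strict_mono k" and E: "E \<in> Tan B 0" "E \<in> closed_sets0"
      and conv: "aw_converges (\<lambda>i. blow_up (t (k i)) B) E"
    using Tan_of_blow_ups[OF B, of t] rt(1) by blast
  note limit = approximable_limit[OF conv blow_up_closed_sets0[OF B] E(2), of _ _ \<T>]
  have "approximable \<T> \<phi> R E" if "R > 1" for R
  proof -
    have "2 * R > 0" using \<open>R > 1\<close> by simp
    have "\<forall>\<^sub>F i in sequentially. nat \<lceil>2 * R\<rceil> \<le> i" by (rule eventually_ge_at_top)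
    then have "\<forall>\<^sub>F i in sequentially. approximable \<T> \<phi> R E"
      using limit[OF \<delta>(1) \<open>2 * R > 0\<close>]
    proof eventually_elim
      case (elim i)
      have "2 * R \<le> real (Suc (k i))" using elim(1) seq_suble[OF k, of i] by linarith
      then have "2 * R * t (k i) \<le> t (k i) * real (Suc (k i))"
        using rt(1)[of "k i"] by (simp add: mult.commute del: of_nat_Suc)
      from this rt(2) have "2 * R * t (k i) \<le> r (k i)" by (rule order_trans)
      then have "N (2 * R * t (k i))"
        using rt(1)[of "k i"] \<open>R > 1\<close> by (intro rt(5)[of "k i"]) auto
      then show ?case
        using elim(2) rt(1) \<delta> by (simp add: N_def approximable_blow_up[OF \<T>])
    qed
    then show ?thesis by simp
  qed
  then have "E \<in> aw_closure \<T>" using \<phi>(2)[of E 1] E Tan by auto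
  then have "approximable \<T> (\<delta> / 4) 2 E" using \<delta> by (simp add: aw_closure_iff_approximable[OF \<T>])
  with limit[of "\<delta> / 4" 2] \<delta>(1) have "\<forall>\<^sub>F i in sequentially. N (t (k i))"
    by (simp add: N_def approximable_blow_up[OF \<T> rt(1)] eventually_conj_iff)
  with rt(4) show False by simp
qed

text \<open>A small limit inferior for \<open>D\<close> only yields approximability of \<open>D\<close> at certain scales \<open>r\<close>, so a
  blow-up of \<open>D\<close> at these scales would be controlled in the unit ball alone. Blowing up at the smaller
  scales \<open>r / j\<close>, with error of order \<open>1 / j^2\<close> at scale \<open>r\<close>, gives error of order \<open>1 / j\<close> in absolute
  terms on the ball of radius \<open>j\<close>. As \<open>D\<close> is itself a limit of blow-ups of \<open>B\<close>, this can be done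
  directly with \<open>B\<close>.\<close>

lemma Tan_subset_singular_class_if_disjoint:
  assumes \<T>: "local_approx_class \<T>" and B: "B \<in> closed_sets0"
    and disj: "Tan B 0 \<inter> aw_closure \<T> = {}"
  shows "Tan B 0 \<subseteq> singular_class \<T>"
proof (rule ccontr)
  assume "\<not> Tan B 0 \<subseteq> singular_class \<T>"
  then obtain D where D: "D \<in> Tan B 0" "D \<in> closed_sets0" "D \<notin> singular_class \<T>"
    using TanE by blast
  then have "Liminf (at_right 0) (\<lambda>r. approximability \<T> D 0 r) = 0"
    by (simp add: singular_class_def)
  have small: "\<exists>r>0. r < 1 \<and> approximable \<T> \<eta> r D" if "\<eta> > 0" for \<eta>
  proof (rule ccontr)
    assume neg: "\<not> (\<exists>r>0. r < 1 \<and> approximable \<T> \<eta> r D)"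
    have "\<forall>\<^sub>F r in at_right 0. r < (1::real)" "\<forall>\<^sub>F r in at_right 0. r > (0::real)"
      by (auto simp: eventually_at_right_less intro: eventually_at_rightI[of 0 1])
    then have "\<forall>\<^sub>F r in at_right 0. ennreal \<eta> \<le> approximability \<T> D 0 r"
    proof eventually_elim
      case (elim r)
      then have "\<not> approximability \<T> D 0 r < ennreal \<eta>"
        using neg approximability_less_imp[of \<T> D 0 r \<eta>] by auto
      then show ?case by simp
    qed
    then have "ennreal \<eta> \<le> Liminf (at_right 0) (\<lambda>r. approximability \<T> D 0 r)"
      by (rule Liminf_bounded)
    with \<open>Liminf _ _ = 0\<close> \<open>\<eta> > 0\<close> show False by simp
  qed
  have "\<exists>t. 0 < t \<and> t < inverse (real (Suc j)) \<and>
      approximable \<T> (inverse ((real (Suc j))\<^sup>2)) (real (Suc j) * t) B" for j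
  proof -
    define M where "M = real (Suc j)"
    have "M > 0" by (simp add: M_def)
    \<comment> \<open>the factor four is lost in passing from \<open>D\<close> to \<open>B\<close>\<close>
    define \<eta> where "\<eta> = inverse (M\<^sup>2) / 4"
    have "\<eta> > 0" using \<open>M > 0\<close> by (simp add: \<eta>_def)
    then obtain r where r: "0 < r" "r < 1" "approximable \<T> \<eta> r D" using small by blast
    obtain s where s: "0 < s" "s < 1" "approximable \<T> (4 * \<eta>) (r / 2 * s) B"
      using Tan_approximable[OF \<T> B D(1) \<open>\<eta> > 0\<close> r(1), of 1] r(3) by auto
    have "r * s < 1" using mult_strict_mono[of r 1 s 1] r s by simp
    then have "r / 2 * s / M < inverse M" using \<open>M > 0\<close> by (simp add: field_simps)
    moreover have "approximable \<T> (inverse (M\<^sup>2)) (M * (r / 2 * s / M)) B"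
      using s(3) \<open>M > 0\<close> by (simp add: \<eta>_def)
    ultimately show ?thesis
      using r s \<open>M > 0\<close> unfolding M_def[symmetric] by (intro exI[of _ "r / 2 * s / M"]) simp
  qed
  then obtain t where t: "\<And>j. 0 < t j" "\<And>j. t j < inverse (real (Suc j))"
    "\<And>j. approximable \<T> (inverse ((real (Suc j))\<^sup>2)) (real (Suc j) * t j) B" by metis
  have "t \<longlonglongrightarrow> 0"
    using t(1,2) by (intro tendsto_sandwich[OF _ _ tendsto_const LIMSEQ_inverse_real_of_nat])
      (auto simp: less_imp_le simp del: of_nat_Suc)
  then obtain k E where k: "strict_mono k" and E: "E \<in> Tan B 0" "E \<in> closed_sets0"
      and conv: "aw_converges (\<lambda>i. blow_up (t (k i)) B) E"
    using Tan_of_blow_ups[OF B, of t] t(1) by blast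
  have "approximable \<T> \<delta> r E" if "\<delta> > 0" "r > 0" for \<delta> r
  proof -
    \<comment> \<open>beyond \<open>m\<close>, the ball of radius \<open>M\<close> contains the one of radius \<open>2 * r\<close> and the absolute error
      \<open>inverse M\<close> is at most \<open>\<delta> / 4 * (2 * r)\<close>\<close>
    define m where "m = max (2 * r) (inverse (\<delta> / 4 * (2 * r)))"
    have pos: "\<delta> / 4 > 0" "2 * r > 0" using that by auto
    have "\<forall>\<^sub>F i in sequentially. nat \<lceil>m\<rceil> \<le> i" by (rule eventually_ge_at_top)
    then have "\<forall>\<^sub>F i in sequentially. approximable \<T> \<delta> r E"
      using approximable_limit[OF conv blow_up_closed_sets0[OF B] E(2) pos, of \<T>]
    proof eventually_elim
      case (elim i)
      define M where "M = real (Suc (k i))"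
      have M: "M > 0" "M \<ge> 2 * r" "M \<ge> inverse (\<delta> / 4 * (2 * r))"
        using elim(1) seq_suble[OF k, of i] by (auto simp: M_def m_def)
      have "inverse M \<le> \<delta> / 4 * (2 * r)"
        using le_imp_inverse_le[OF M(3)] that by simp
      moreover have "approximable \<T> (inverse (M\<^sup>2)) M (blow_up (t (k i)) B)"
        using t(3)[of "k i"] by (simp add: approximable_blow_up[OF \<T> t(1)] M_def)
      ultimately have "approximable \<T> (\<delta> / 4) (2 * r) (blow_up (t (k i)) B)"
        using M by (elim approximable_mono) (simp_all add: power2_eq_square field_simps)
      then show ?case using elim(2) by simp
    qed
    then show ?thesis by simp
  qed
  then have "E \<in> aw_closure \<T>" using E by (simp add: aw_closure_iff_approximable[OF \<T>])
  with E disj show False by blast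
qed

section \<open>Sets that are locally well approximated\<close>

text \<open>Points of \<open>closure C\<close> in the smaller ball are limits of points of \<open>C\<close> in the larger ball; the
  boundary of a ball makes some loss of radius unavoidable.\<close>

lemma approximable_closure:
  assumes "approximable \<T> \<delta> r C" "\<delta> > 0" "r > 0"
  shows "approximable \<T> (2 * \<delta>) (r / 2) (closure C)"
proof -
  obtain T where T: "T \<in> \<T>" "aw_near r (\<delta> * r) C T"
    using assms by (auto simp: approximable_def)
  have "aw_near (r / 2) (\<delta> * r) (closure C) T"
    unfolding aw_near_def
  proof safe
    fix a assume a: "a \<in> closure C" "a \<in> cball 0 (r / 2)"
    show "infdist a T \<le> \<delta> * r"
    proof (rule field_le_epsilon)
      fix e :: real assume "e > 0"
      then obtain c where c: "c \<in> C" "dist c a < min e (r / 2)"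
        using a(1) \<open>r > 0\<close> unfolding closure_approachable by (metis half_gt_zero min_less_iff_conj)
      have "norm c \<le> norm a + dist c a"
        by (simp add: dist_norm norm_triangle_sub)
      with a c have "norm c \<le> r" by auto
      then have "infdist c T \<le> \<delta> * r" using T(2) c by (simp add: aw_near_def)
      with infdist_triangle[of a T c] c show "infdist a T \<le> \<delta> * r + e"
        by (simp add: dist_commute)
    qed
  next
    fix b assume b: "b \<in> T" "b \<in> cball 0 (r / 2)"
    then have "infdist b C \<le> \<delta> * r" using T(2) \<open>r > 0\<close> by (auto simp: aw_near_def)
    moreover have "infdist b (closure C) \<le> infdist b C"
    proof (cases "C = {}")
      case False then show ?thesis by (intro infdist_mono closure_subset)
    qed simp
    ultimately show "infdist b (closure C) \<le> \<delta> * r" by simp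
  qed
  with T show ?thesis by (auto simp: approximable_def)
qed

lemma locally_well_approximated_Tan_subset:
  assumes \<S>: "local_approx_class \<S>" and A: "locally_well_approximated A \<S>" and x: "x \<in> A"
  shows "Tan (closure A) x \<subseteq> aw_closure \<S>"
proof -
  define C where "C = (\<lambda>y. y - x) ` A"
  have C: "closure C = (\<lambda>y. y - x) ` closure A"
    using closure_translation_subtract by (simp add: C_def)
  have "0 \<in> C" using x by (auto simp: C_def)
  then have "closure C \<in> closed_sets0" using closure_subset by (auto simp: closed_sets0_def)
  moreover have "\<exists>\<rho>>0. \<forall>r. 0 < r \<and> r < \<rho> \<longrightarrow> approximable \<S> \<delta> r (closure C)" if "\<delta> > 0" for \<delta>
  proof -
    have "compact {x}" "{x} \<subseteq> A" "\<delta> / 4 > 0" using x that by auto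
    then obtain r\<^sub>0 where r\<^sub>0: "r\<^sub>0 > 0"
      "\<And>r. 0 < r \<Longrightarrow> r \<le> r\<^sub>0 \<Longrightarrow> approximability \<S> A x r \<le> ennreal (\<delta> / 4)"
      using A unfolding locally_well_approximated_def by (metis singletonI)
    have "approximable \<S> \<delta> r (closure C)" if "0 < r" "r < r\<^sub>0 / 2" for r
    proof -
      have "approximability \<S> A x (2 * r) \<le> ennreal (\<delta> / 4)" using r\<^sub>0(2)[of "2 * r"] that by simp
      also have "\<dots> < ennreal (\<delta> / 2)" using \<open>\<delta> > 0\<close> by (simp add: ennreal_less_iff)
      finally have "approximable \<S> (\<delta> / 2) (2 * r) C"
        unfolding C_def using that by (intro approximability_less_imp) auto
      then show ?thesis
        using approximable_closure[of \<S> "\<delta> / 2" "2 * r" C] that \<open>\<delta> > 0\<close> by simp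
    qed
    then show ?thesis using r\<^sub>0(1) by (intro exI[of _ "r\<^sub>0 / 2"]) auto
  qed
  ultimately have "Tan (closure C) 0 \<subseteq> aw_closure \<S>" by (intro Tan_subset_aw_closure[OF \<S>])
  then show ?thesis by (simp add: Tan_eq_Tan_translate[of "closure A"] C)
qed

theorem theorem6p1:
  fixes \<T> \<S> :: "(real ^ 'n) set set" and A :: "(real ^ 'n) set"
  assumes "local_approx_class \<T>" and "local_approx_class \<S>"
    and "separated_at_infinity \<T> (aw_closure \<S>)"
    and "A \<noteq> {}"
    and "locally_well_approximated A \<S>"
  shows "\<exists>A\<^sub>T A\<^sub>P. A = A\<^sub>T \<union> A\<^sub>P \<and> A\<^sub>T \<inter> A\<^sub>P = {} \<and>
           (\<forall>x\<in>A\<^sub>T. Tan (closure A) x \<subseteq> aw_closure \<S> \<inter> aw_closure \<T>) \<and>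
           (\<forall>x\<in>A\<^sub>P. Tan (closure A) x \<subseteq> aw_closure \<S> \<inter> singular_class \<T>)"
proof -
  define A\<^sub>T where "A\<^sub>T = {x \<in> A. Tan (closure A) x \<inter> aw_closure \<T> \<noteq> {}}"
  have in_S: "Tan (closure A) x \<subseteq> aw_closure \<S>" if "x \<in> A" for x
    using locally_well_approximated_Tan_subset assms that by blast
  have B: "(\<lambda>y. y - x) ` closure A \<in> closed_sets0" if "x \<in> A" for x
    using that closure_subset[of A] closed_translation_subtract[of "closure A" x]
    by (auto simp: closed_sets0_def)
  have "Tan (closure A) x \<subseteq> aw_closure \<T>" if "x \<in> A\<^sub>T" for x
  proof -
    have "x \<in> A" "Tan (closure A) x \<inter> aw_closure \<T> \<noteq> {}" using that by (auto simp: A\<^sub>T_def)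
    then show ?thesis
      using Tan_subset_aw_closure_if_meets[OF assms(1,3) B] in_S by (metis Tan_eq_Tan_translate)
  qed
  moreover have "Tan (closure A) x \<subseteq> singular_class \<T>" if "x \<in> A - A\<^sub>T" for x
  proof -
    have "x \<in> A" "Tan (closure A) x \<inter> aw_closure \<T> = {}" using that by (auto simp: A\<^sub>T_def)
    then show ?thesis
      using Tan_subset_singular_class_if_disjoint[OF assms(1) B] by (metis Tan_eq_Tan_translate)
  qed
  ultimately show ?thesis
    using in_S by (intro exI[of _ A\<^sub>T] exI[of _ "A - A\<^sub>T"]) (auto simp: A\<^sub>T_def)
qed

end
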